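(* Let $n\ge1$ and let $\mu$ be a complete matching of the cyclic Hollow-Shell $C_n$. Put $d(g)=(\mu(g)-g)\bmod n$ for each man $g$ and $e(h)=(h-\mu^{-1}(h))\bmod n$ for each woman $h$. Then $(m_g,w_h)$ blocks $\mu$ if and only if $$e(h)<(h-g)\bmod n<d(g).$$ Consequently, with $D_x=\{g:d(g)>x\}$, $E_x=\{h:e(h)<x\}$ and $E_x-x=\{h-x:h\in E_x\}$ (indices taken modulo $n$), $$B_{C_n}(\mu)=\sum_{x=1}^{n-1}\bigl|D_x\cap(E_x-x)\bigr| .$$
   Context: Men and women are indexed by $\{0,\dots,n-1\}$, identified with $\mathbb{Z}/n\mathbb{Z}$; $\bmod\ n$ takes values in $\{0,\dots,n-1\}$. A complete matching is a bijection $\mu$ from men to women. $(m_g,w_h)$ blocks $\mu$ if $m_g$ strictly prefers $w_h$ to his partner under $\mu$ and $w_h$ strictly prefers $m_g$ to her partner under $\mu$; $B_{C_n}(\mu)$ is the number of blocking pairs of $\mu$ in $C_n$. $r_M(g,h)$ is the rank (1 is best) of woman $h$ in man $g$'s list and $r_W(h,g)$ the rank of man $g$ in woman $h$'s list. The cyclic Hollow-Shell $C_n$ is the instance with $r_M(g,h)=((h-g)\bmod n)+1$ and $r_W(h,g)=n-((h-g)\bmod n)$. *)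

theory Defs
  imports Main
begin

text \<open>Men and women are both represented by the integers in \<open>{0..<n}\<close>. Integers (rather than
  naturals) make \<open>(h - g) mod n\<close> the residue in \<open>{0..<n}\<close>, with no truncated subtraction.\<close>

text \<open>A marriage instance given by rank functions (rank 1 is best): \<open>man_rank I g h\<close> is the rank of
  woman \<open>h\<close> in the list of man \<open>g\<close>, and \<open>woman_rank I h g\<close> that of man \<open>g\<close> in the list of
  woman \<open>h\<close>. Rank functions are only meaningful for arguments in \<open>{0..<size_of I}\<close>.\<close>

record marriage_instance =
  size_of :: int
  man_rank :: "int \<Rightarrow> int \<Rightarrow> int"
  woman_rank :: "int \<Rightarrow> int \<Rightarrow> int"

abbreviation persons :: "marriage_instance \<Rightarrow> int set" where
  "persons I \<equiv> {0..<size_of I}"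

definition complete_matching :: "marriage_instance \<Rightarrow> (int \<Rightarrow> int) \<Rightarrow> bool" where
  "complete_matching I \<mu> \<longleftrightarrow> bij_betw \<mu> (persons I) (persons I)"

definition husband :: "marriage_instance \<Rightarrow> (int \<Rightarrow> int) \<Rightarrow> int \<Rightarrow> int" where
  "husband I \<mu> h = inv_into (persons I) \<mu> h"

definition man_prefers :: "marriage_instance \<Rightarrow> int \<Rightarrow> int \<Rightarrow> int \<Rightarrow> bool" where
  "man_prefers I g h h' \<longleftrightarrow> man_rank I g h < man_rank I g h'"

definition woman_prefers :: "marriage_instance \<Rightarrow> int \<Rightarrow> int \<Rightarrow> int \<Rightarrow> bool" where
  "woman_prefers I h g g' \<longleftrightarrow> woman_rank I h g < woman_rank I h g'"

definition blocks :: "marriage_instance \<Rightarrow> (int \<Rightarrow> int) \<Rightarrow> int \<Rightarrow> int \<Rightarrow> bool" where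
  "blocks I \<mu> g h \<longleftrightarrow> man_prefers I g h (\<mu> g) \<and> woman_prefers I h g (husband I \<mu> h)"

definition num_blocking :: "marriage_instance \<Rightarrow> (int \<Rightarrow> int) \<Rightarrow> nat" where
  "num_blocking I \<mu> = card {(g, h). g \<in> persons I \<and> h \<in> persons I \<and> blocks I \<mu> g h}"

definition hollow_shell :: "int \<Rightarrow> marriage_instance" where
  "hollow_shell n = \<lparr> size_of = n,
     man_rank = (\<lambda>g h. (h - g) mod n + 1),
     woman_rank = (\<lambda>h g. n - (h - g) mod n) \<rparr>"

definition man_disp :: "int \<Rightarrow> (int \<Rightarrow> int) \<Rightarrow> int \<Rightarrow> int" where
  "man_disp n \<mu> g = (\<mu> g - g) mod n"

definition woman_disp :: "int \<Rightarrow> (int \<Rightarrow> int) \<Rightarrow> int \<Rightarrow> int" where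
  "woman_disp n \<mu> h = (h - husband (hollow_shell n) \<mu> h) mod n"

definition men_above :: "int \<Rightarrow> (int \<Rightarrow> int) \<Rightarrow> int \<Rightarrow> int set" where
  "men_above n \<mu> x = {g \<in> {0..<n}. man_disp n \<mu> g > x}"

definition women_below :: "int \<Rightarrow> (int \<Rightarrow> int) \<Rightarrow> int \<Rightarrow> int set" where
  "women_below n \<mu> x = {h \<in> {0..<n}. woman_disp n \<mu> h < x}"

definition shift_down :: "int \<Rightarrow> int set \<Rightarrow> int \<Rightarrow> int set" where
  "shift_down n A x = (\<lambda>h. (h - x) mod n) ` A"

end

theory Submission
  imports Defs
begin

text \<open>Everything depends on the offset (h - g) mod n of a pair. A man's rank of a woman
  increases with it and a woman's rank of a man decreases with it, so g wants an offset below
  \<open>man_disp n \<mu> g\<close> and h wants one above \<open>woman_disp n \<mu> h\<close>; this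
  gives \<open>blocks_hollow_shell_iff\<close>. For the count, sort the blocking pairs by offset x.
  Given x, the man determines the woman as g + x modulo n, so these pairs correspond to the men g
  with d(g) > x and e(g + x) < x. By \<open>mem_shift_down_iff\<close> they form the intersection of
  D_x with E_x - x.\<close>

lemma blocks_hollow_shell_iff:
  "blocks (hollow_shell n) \<mu> g h \<longleftrightarrow>
    woman_disp n \<mu> h < (h - g) mod n \<and> (h - g) mod n < man_disp n \<mu> g"
  by (auto simp: blocks_def man_prefers_def woman_prefers_def hollow_shell_def
      man_disp_def woman_disp_def)

text \<open>Translation by x permutes the residues modulo n, so an image under subtraction is a
  preimage under addition. Both g and the elements of \<open>A\<close> are reduced residues, so the
  final reduction returns them unchanged.\<close>

lemma mem_shift_down_iff:
  assumes "A \<subseteq> {0..<n}" "g \<in> {0..<n}"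
  shows "g \<in> shift_down n A x \<longleftrightarrow> (g + x) mod n \<in> A"
proof
  assume "g \<in> shift_down n A x"
  then obtain h where "h \<in> A" "g = (h - x) mod n"
    by (auto simp: shift_down_def)
  moreover from this have "(g + x) mod n = h"
    using assms(1) by (auto simp: mod_simps)
  ultimately show "(g + x) mod n \<in> A" by simp
next
  assume "(g + x) mod n \<in> A"
  moreover have "((g + x) mod n - x) mod n = g"
    using assms(2) by (simp add: mod_simps)
  ultimately show "g \<in> shift_down n A x"
    unfolding shift_down_def by (metis image_eqI)
qed

theorem proposition5p1:
  fixes n :: int and \<mu> :: "int \<Rightarrow> int"
  assumes "n \<ge> 1"
    and "complete_matching (hollow_shell n) \<mu>"
  shows "(\<forall>g\<in>{0..<n}. \<forall>h\<in>{0..<n}.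
            blocks (hollow_shell n) \<mu> g h \<longleftrightarrow>
              woman_disp n \<mu> h < (h - g) mod n \<and> (h - g) mod n < man_disp n \<mu> g)
       \<and> num_blocking (hollow_shell n) \<mu> =
           (\<Sum>x = 1..n - 1. card (men_above n \<mu> x \<inter> shift_down n (women_below n \<mu> x) x))"
proof (intro conjI ballI)
  fix g h
  show "blocks (hollow_shell n) \<mu> g h \<longleftrightarrow>
      woman_disp n \<mu> h < (h - g) mod n \<and> (h - g) mod n < man_disp n \<mu> g"
    by (rule blocks_hollow_shell_iff)
next
  let ?S = "\<lambda>x. men_above n \<mu> x \<inter> shift_down n (women_below n \<mu> x) x"
  let ?P = "{(g, h). g \<in> {0..<n} \<and> h \<in> {0..<n} \<and> blocks (hollow_shell n) \<mu> g h}"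
  have mem_S: "g \<in> ?S x \<longleftrightarrow>
      g \<in> {0..<n} \<and> x < man_disp n \<mu> g \<and> woman_disp n \<mu> ((g + x) mod n) < x" for g x
  proof (cases "g \<in> {0..<n}")
    case True
    moreover have "women_below n \<mu> x \<subseteq> {0..<n}"
      by (auto simp: women_below_def)
    ultimately show ?thesis
      using mem_shift_down_iff[of "women_below n \<mu> x" n g x] \<open>n \<ge> 1\<close>
      by (auto simp: men_above_def women_below_def)
  qed (auto simp: men_above_def)
  \<comment> \<open>In this range x is its own residue, so it can be read back from the
    pair.\<close>
  have diff: "((g + x) mod n - g) mod n = x" if "x \<in> {1..n - 1}" for g x
    using that by (simp add: mod_simps)
  have "bij_betw (\<lambda>(x, g). (g, (g + x) mod n)) (Sigma {1..n - 1} ?S) ?P"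
  \<comment> \<open>The inverse sends a pair to its offset and its man. The cases are the two
    inverse laws, then the two inclusions of images.\<close>
  proof (rule bij_betw_byWitness[where f' = "\<lambda>(g, h). ((h - g) mod n, g)"], goal_cases)
    case 1
    show ?case using diff by auto
  next
    case 2
    show ?case by (auto simp: mod_simps)
  next
    case 3
    have "(g, (g + x) mod n) \<in> ?P" if "x \<in> {1..n - 1}" "g \<in> ?S x" for x g
      using that(2)[unfolded mem_S] diff[OF that(1)] \<open>n \<ge> 1\<close>
      by (simp add: blocks_hollow_shell_iff)
    then show ?case by fast
  next
    case 4
    have "(h - g) mod n \<in> {1..n - 1}" "g \<in> ?S ((h - g) mod n)"
      if "(g, h) \<in> ?P" for g h
    proof -
      have "(g + (h - g) mod n) mod n = h"
        using that by (simp add: mod_simps)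
      then show "g \<in> ?S ((h - g) mod n)"
        using that unfolding mem_S by (simp add: blocks_hollow_shell_iff)
      \<comment> \<open>A blocking offset strictly exceeds this nonnegative residue, so it is at
        least 1; that is why the sum can start at 1.\<close>
      have "0 \<le> woman_disp n \<mu> h"
        using \<open>n \<ge> 1\<close> by (simp add: woman_disp_def)
      moreover have "(h - g) mod n < n"
        using \<open>n \<ge> 1\<close> by simp
      ultimately show "(h - g) mod n \<in> {1..n - 1}"
        using that by (simp add: blocks_hollow_shell_iff)
    qed
    then show ?case by fast
  qed
  \<comment> \<open>Finite fibres make the cardinality of the \<open>Sigma\<close> set the sum of
    the fibre cardinalities.\<close>
  moreover have "finite (?S x)" for x
    by (rule finite_subset[of _ "{0..<n}"]) (auto simp: men_above_def)
  ultimately have "card ?P = (\<Sum>x = 1..n - 1. card (?S x))"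
    using bij_betw_same_card by (fastforce simp: card_SigmaI)
  then show "num_blocking (hollow_shell n) \<mu> = (\<Sum>x = 1..n - 1. card (?S x))"
    by (simp add: num_blocking_def hollow_shell_def)
qed

end
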